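(* Let $g:\mathbb{R}^n\to\mathbb{R}$ and $q=(q_1,\dots,q_m):\mathbb{R}^n\to\mathbb{R}^m$ be twice continuously differentiable, let $\Gamma=\{x: q_i(x)\le 0,\ i=1,\dots,m\}$, and consider the problem of minimizing $g(x)$ subject to $x\in\Gamma$. Let $\bar x\in\Gamma$ be a stationary point of this problem at which MSCQ is valid. Then $\bar x$ is a tilt-stable local minimizer of the problem provided that the strong second-order sufficient condition (SSOSC) is satisfied at $\bar x$.
   Context: Norms are Euclidean; $\mathbb{B}_r(a)$ is the closed ball of radius $r$ about $a$; $d(\cdot\,;\cdot)$ is the distance from a point to a set; $\mathbb{R}^m_-$ and $\mathbb{R}^m_+$ are the nonpositive and nonnegative orthants. Active indices: $I(x)=\{i:q_i(x)=0\}$ for $x\in\Gamma$; $I^+(\lambda)=\{i:\lambda_i>0\}$ for $\lambda\in\mathbb{R}^m_+$. Lagrangian: $L(x,\lambda)=g(x)+\lambda^Tq(x)$. A point $x\in\Gamma$ is stationary if there is $\lambda\in\mathbb{R}^m_+$ with $\nabla_xL(x,\lambda)=0$ and $\lambda_iq_i(x)=0$ for all $i$. Multipliers: $\Lambda(x,x^* )=\{\lambda\in\mathbb{R}^m_+:\nabla q(x)^T\lambda=x^*,\ \lambda_i=0\text{ for }i\notin I(x)\}$. MSCQ (metric subregularity constraint qualification) holds at $\bar x\in\Gamma$ if there are a neighborhood $U$ of $\bar x$ and $c>0$ such that $d(x;\Gamma)\le c\,d(q(x);\mathbb{R}^m_-)$ for all $x\in U$. SSOSC holds at $\bar x$ if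 for all $\lambda\in\Lambda(\bar x,-\nabla g(\bar x))$ one has $\langle w,\nabla^2_{xx}L(\bar x,\lambda)w\rangle>0$ whenever $w\ne0$ with $\langle\nabla q_i(\bar x),w\rangle=0$ for all $i\in I^+(\lambda)$. Tilt stability: $\bar x\in\Gamma$ is a tilt-stable local minimizer of the problem with modulus $\kappa>0$ if there is $\gamma_0>0$ such that the mapping $v\mapsto\operatorname{argmin}\{g(x)-\langle v,x\rangle: x\in\Gamma\cap\mathbb{B}_{\gamma_0}(\bar x)\}$ is single-valued and Lipschitz continuous with constant $\kappa$ on some neighborhood of $0\in\mathbb{R}^n$, with value $\bar x$ at $v=0$. It is a tilt-stable local minimizer if this holds for some $\kappa>0$. *)

theory Defs
  imports "HOL-Analysis.Analysis"
begin

section \<open>Gradients, Hessians and twice continuous differentiability\<close>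

text \<open>\<open>grad f x\<close> and \<open>hessian f x\<close> are meaningful only where \<open>f\<close>, respectively \<open>grad f\<close>,
  is Frechet differentiable; below they are used for twice continuously differentiable functions.\<close>

definition grad :: "(real ^ 'n \<Rightarrow> real) \<Rightarrow> real ^ 'n \<Rightarrow> real ^ 'n" where
  "grad f x = (THE D. GDERIV f x :> D)"

definition hessian :: "(real ^ 'n \<Rightarrow> real) \<Rightarrow> real ^ 'n \<Rightarrow> real ^ 'n ^ 'n" where
  "hessian f x = jacobian (grad f) (at x)"

definition twice_cont_diff :: "(real ^ 'n \<Rightarrow> real) \<Rightarrow> bool" where
  "twice_cont_diff f \<longleftrightarrow>
     (\<forall>x. f differentiable (at x)) \<and>
     (\<forall>x. grad f differentiable (at x)) \<and>
     continuous_on UNIV (hessian f)"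

section \<open>The nonlinear program: minimize \<open>g x\<close> subject to \<open>q x $ i \<le> 0\<close> for all \<open>i\<close>\<close>

definition nonneg_orthant :: "(real ^ 'm) set" where
  "nonneg_orthant = {y. \<forall>i. 0 \<le> y $ i}"

definition nonpos_orthant :: "(real ^ 'm) set" where
  "nonpos_orthant = {y. \<forall>i. y $ i \<le> 0}"

definition feasible_set :: "(real ^ 'n \<Rightarrow> real ^ 'm) \<Rightarrow> (real ^ 'n) set" where
  "feasible_set q = {x. \<forall>i. q x $ i \<le> 0}"

definition active_indices :: "(real ^ 'n \<Rightarrow> real ^ 'm) \<Rightarrow> real ^ 'n \<Rightarrow> 'm set" where
  "active_indices q x = {i. q x $ i = 0}"

definition positive_indices :: "real ^ 'm \<Rightarrow> 'm set" where
  "positive_indices l = {i. 0 < l $ i}"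

definition lagrangian ::
  "(real ^ 'n \<Rightarrow> real) \<Rightarrow> (real ^ 'n \<Rightarrow> real ^ 'm) \<Rightarrow> real ^ 'n \<Rightarrow> real ^ 'm \<Rightarrow> real" where
  "lagrangian g q x l = g x + l \<bullet> q x"

definition stationary_point ::
  "(real ^ 'n \<Rightarrow> real) \<Rightarrow> (real ^ 'n \<Rightarrow> real ^ 'm) \<Rightarrow> real ^ 'n \<Rightarrow> bool" where
  "stationary_point g q x \<longleftrightarrow>
     x \<in> feasible_set q \<and>
     (\<exists>l\<in>nonneg_orthant. grad (\<lambda>y. lagrangian g q y l) x = 0 \<and> (\<forall>i. l $ i * q x $ i = 0))"

definition multipliers ::
  "(real ^ 'n \<Rightarrow> real ^ 'm) \<Rightarrow> real ^ 'n \<Rightarrow> real ^ 'n \<Rightarrow> (real ^ 'm) set" where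
  "multipliers q x xs =
     {l \<in> nonneg_orthant. transpose (jacobian q (at x)) *v l = xs \<and>
                          (\<forall>i. i \<notin> active_indices q x \<longrightarrow> l $ i = 0)}"

text \<open>The metric subregularity constraint qualification. Both distances are to nonempty sets when
  \<open>xbar\<close> is feasible, so the convention that \<open>infdist\<close> to the empty set is 0 plays no role.\<close>

definition MSCQ :: "(real ^ 'n \<Rightarrow> real ^ 'm) \<Rightarrow> real ^ 'n \<Rightarrow> bool" where
  "MSCQ q xbar \<longleftrightarrow>
     xbar \<in> feasible_set q \<and>
     (\<exists>U c. open U \<and> xbar \<in> U \<and> 0 < c \<and>
        (\<forall>x\<in>U. infdist x (feasible_set q) \<le> c * infdist (q x) nonpos_orthant))"

definition SSOSC ::
  "(real ^ 'n \<Rightarrow> real) \<Rightarrow> (real ^ 'n \<Rightarrow> real ^ 'm) \<Rightarrow> real ^ 'n \<Rightarrow> bool" where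
  "SSOSC g q xbar \<longleftrightarrow>
     (\<forall>l\<in>multipliers q xbar (- grad g xbar). \<forall>w.
        w \<noteq> 0 \<and> (\<forall>i\<in>positive_indices l. grad (\<lambda>y. q y $ i) xbar \<bullet> w = 0) \<longrightarrow>
        0 < w \<bullet> (hessian (\<lambda>y. lagrangian g q y l) xbar *v w))"

section \<open>Tilt stability\<close>

definition tilted_argmin ::
  "(real ^ 'n \<Rightarrow> real) \<Rightarrow> (real ^ 'n \<Rightarrow> real ^ 'm) \<Rightarrow> real ^ 'n \<Rightarrow> real \<Rightarrow> real ^ 'n \<Rightarrow> (real ^ 'n) set"
where
  "tilted_argmin g q xbar \<gamma> v =
     {x. is_arg_min (\<lambda>x. g x - v \<bullet> x) (\<lambda>x. x \<in> feasible_set q \<inter> cball xbar \<gamma>) x}"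

definition tilt_stable_with_modulus ::
  "(real ^ 'n \<Rightarrow> real) \<Rightarrow> (real ^ 'n \<Rightarrow> real ^ 'm) \<Rightarrow> real ^ 'n \<Rightarrow> real \<Rightarrow> bool" where
  "tilt_stable_with_modulus g q xbar \<kappa> \<longleftrightarrow>
     xbar \<in> feasible_set q \<and> 0 < \<kappa> \<and>
     (\<exists>\<gamma>>0. \<exists>V s. open V \<and> 0 \<in> V \<and>
        (\<forall>v\<in>V. tilted_argmin g q xbar \<gamma> v = {s v}) \<and>
        \<kappa>-lipschitz_on V s \<and> s 0 = xbar)"

definition tilt_stable_local_minimizer ::
  "(real ^ 'n \<Rightarrow> real) \<Rightarrow> (real ^ 'n \<Rightarrow> real ^ 'm) \<Rightarrow> real ^ 'n \<Rightarrow> bool" where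
  "tilt_stable_local_minimizer g q xbar \<longleftrightarrow> (\<exists>\<kappa>>0. tilt_stable_with_modulus g q xbar \<kappa>)"

end

theory Submission
  imports Defs
begin

text \<open>
  The strong second-order condition forces a quadratic growth that is uniform in the base point
  and in the multiplier, as long as the multipliers stay in a bounded set
  (\<open>uniform_quadratic_growth\<close>): if \<open>x\<close> and \<open>y\<close> are feasible and close to \<open>xbar\<close>, \<open>l \<ge> 0\<close> is
  bounded and complementary to \<open>q x\<close>, and \<open>v = grad (lagrangian g q \<cdot> l) x\<close> is small, then
  \<open>g y - g x - (y - x) \<bullet> v \<ge> \<alpha> * (norm (y - x))\<^sup>2\<close>. By Taylor expansion the left-hand side is
  \<open>- l \<bullet> q y\<close>, which is nonnegative, plus half the Hessian form of the Lagrangian, up to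
  \<open>o((norm (y - x))\<^sup>2)\<close>. Either the direction \<open>y - x\<close> is nearly orthogonal to all constraint
  gradients with positive multiplier, and then the Hessian form is positive, or the first term has
  the order of \<open>norm (y - x)\<close> and dominates the quadratic one. The multipliers belonging to
  different base points may have different limits; this causes no harm, because every limit is a
  multiplier at \<open>xbar\<close> and the second-order condition covers all of those.

  Metric subregularity supplies the bounded multipliers (\<open>bounded_multipliers\<close>). The multiplier set
  of a minimizer can be unbounded, but exact penalization, moving along a direction and projecting
  back to the feasible set, always yields a multiplier with entries bounded by the product of the
  subregularity constant and a Lipschitz constant of the objective.

  Both facts together give tilt stability. Growth at \<open>xbar\<close> keeps the minimizers of the tilted
  problems in the interior of the ball, so that they have bounded multipliers. If \<open>x\<close> and \<open>y\<close>
  minimize for the tilts \<open>v\<close> and \<open>w\<close>, adding the growth inequality at \<open>x\<close> to the one at \<open>y\<close>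
  gives \<open>2 * \<alpha> * (norm (y - x))\<^sup>2 \<le> (y - x) \<bullet> (w - v)\<close>, which is uniqueness and Lipschitz
  continuity at once (\<open>tilt_stable_of_quadratic_growth\<close>).
\<close>

section \<open>Gradients, Hessians and second-order expansion\<close>

lemma GDERIV_grad:
  fixes f :: "real ^ 'n \<Rightarrow> real"
  assumes "f differentiable (at x)"
  shows "GDERIV f x :> grad f x"
proof -
  obtain f' where f': "(f has_derivative f') (at x)"
    using assms differentiable_def by blast
  have "f' = (\<lambda>h. h \<bullet> adjoint f' 1)"
    using adjoint_works[OF has_derivative_linear[OF f'], of _ 1] by (auto simp: fun_eq_iff)
  then have ex: "GDERIV f x :> adjoint f' 1"
    using f' unfolding gderiv_def by simp
  then have "D = adjoint f' 1" if "GDERIV f x :> D" for D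
    using that has_derivative_unique[of f "\<lambda>h. h \<bullet> D" x "\<lambda>h. h \<bullet> adjoint f' 1"]
    unfolding gderiv_def by (metis vector_eq_ldot inner_commute)
  with ex show ?thesis
    unfolding grad_def by (metis theI)
qed

lemma grad_eqI:
  fixes f :: "real ^ 'n \<Rightarrow> real"
  assumes "GDERIV f x :> D"
  shows "grad f x = D"
proof -
  have "GDERIV f x :> grad f x"
    using assms GDERIV_grad unfolding gderiv_def differentiable_def by blast
  with assms show ?thesis
    using has_derivative_unique[of f "\<lambda>h. h \<bullet> D" x "\<lambda>h. h \<bullet> grad f x"]
    unfolding gderiv_def by (metis vector_eq_ldot inner_commute)
qed

lemma twice_cont_diffD:
  fixes f :: "real ^ 'n \<Rightarrow> real"
  assumes "twice_cont_diff f"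
  shows "GDERIV f x :> grad f x"
    and "(grad f has_derivative (\<lambda>h. hessian f x *v h)) (at x)"
    and "isCont (hessian f) x" and "isCont (grad f) x" and "isCont f x"
proof -
  have f: "f differentiable (at x)" and f': "grad f differentiable (at x)"
    and H: "continuous_on UNIV (hessian f)"
    using assms unfolding twice_cont_diff_def by auto
  show "GDERIV f x :> grad f x"
    using GDERIV_grad[OF f] .
  show "(grad f has_derivative (\<lambda>h. hessian f x *v h)) (at x)"
    using f' unfolding hessian_def jacobian_works .
  show "isCont (hessian f) x"
    using H by (simp add: continuous_on_eq_continuous_at)
  show "isCont (grad f) x" "isCont f x"
    using f f' by (auto intro: differentiable_imp_continuous_within)
qed

lemma second_order_taylor:
  fixes f :: "real ^ 'n \<Rightarrow> real"
  assumes f: "twice_cont_diff f"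
  shows "\<exists>s. 0 < s \<and> s < 1 \<and>
    f (x + d) = f x + d \<bullet> grad f x + d \<bullet> (hessian f (x + s *\<^sub>R d) *v d) / 2"
proof -
  define p where "p s = x + s *\<^sub>R d" for s :: real
  define D where "D m s = (if m = 0 then f (p s) else if m = 1 then d \<bullet> grad f (p s)
      else d \<bullet> (hessian f (p s) *v d))" for m :: nat and s
  have p: "(p has_derivative (\<lambda>h. h *\<^sub>R d)) (at s)" for s
    unfolding p_def by (auto intro!: derivative_eq_intros)
  have D0: "(D 0 has_field_derivative D 1 s) (at s)" for s
  proof -
    have "((\<lambda>s. f (p s)) has_derivative (\<lambda>h. (h *\<^sub>R d) \<bullet> grad f (p s))) (at s)"
      using has_derivative_compose[OF p] twice_cont_diffD(1)[OF f, of "p s"]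
      unfolding gderiv_def by blast
    moreover have "D 0 = (\<lambda>s. f (p s))" "D 1 s = d \<bullet> grad f (p s)"
      by (auto simp: D_def)
    ultimately show ?thesis
      by (simp add: has_field_derivative_def mult_commute_abs)
  qed
  have D1: "(D 1 has_field_derivative D 2 s) (at s)" for s
  proof -
    have "((\<lambda>s. grad f (p s)) has_derivative (\<lambda>h. hessian f (p s) *v (h *\<^sub>R d))) (at s)"
      using has_derivative_compose[OF p] twice_cont_diffD(2)[OF f, of "p s"] by blast
    then have "((\<lambda>s. d \<bullet> grad f (p s)) has_derivative
        (\<lambda>h. d \<bullet> (hessian f (p s) *v (h *\<^sub>R d)))) (at s)"
      by (rule has_derivative_inner_right)
    moreover have "D 1 = (\<lambda>s. d \<bullet> grad f (p s))" "D 2 s = d \<bullet> (hessian f (p s) *v d)"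
      by (auto simp: D_def)
    ultimately show ?thesis
      by (simp add: has_field_derivative_def mult_commute_abs matrix_vector_mult_scaleR)
  qed
  have "\<exists>t>0. t < 1 \<and> D 0 1 = (\<Sum>m<2. D m 0 / fact m * 1 ^ m) + D 2 t / fact 2 * 1 ^ 2"
  proof (rule Maclaurin)
    show "\<forall>m t. m < 2 \<and> 0 \<le> t \<and> t \<le> 1 \<longrightarrow> (D m has_real_derivative D (Suc m) t) (at t)"
    proof (intro allI impI)
      fix m :: nat and t :: real
      assume "m < 2 \<and> 0 \<le> t \<and> t \<le> 1"
      then have "m = 0 \<or> m = 1"
        by auto
      then show "(D m has_real_derivative D (Suc m) t) (at t)"
        using D0[of t] D1[of t] by (auto simp: numeral_2_eq_2)
    qed
  qed auto
  then show ?thesis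
    by (auto simp: D_def p_def numeral_2_eq_2)
qed

text \<open>Both ends of the increment move. The Lagrange form of the remainder evaluates the Hessian
  on the segment between them, which shrinks to the common limit \<open>a\<close>.\<close>

lemma second_order_quotient_limit:
  fixes f :: "real ^ 'n \<Rightarrow> real"
  assumes f: "twice_cont_diff f" and X: "X \<longlonglongrightarrow> a" and Y: "Y \<longlonglongrightarrow> a"
    and w: "(\<lambda>k. (Y k - X k) /\<^sub>R norm (Y k - X k)) \<longlonglongrightarrow> w"
  shows "(\<lambda>k. (f (Y k) - f (X k) - (Y k - X k) \<bullet> grad f (X k)) / (norm (Y k - X k))\<^sup>2)
           \<longlonglongrightarrow> w \<bullet> (hessian f a *v w) / 2"
proof -
  define d where "d k = Y k - X k" for k
  define u where "u k = d k /\<^sub>R norm (d k)" for k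
  have "\<forall>k. \<exists>s. 0 < s \<and> s < 1 \<and> f (X k + d k) =
      f (X k) + d k \<bullet> grad f (X k) + d k \<bullet> (hessian f (X k + s *\<^sub>R d k) *v d k) / 2"
    using second_order_taylor[OF f] by blast
  then obtain s where s: "\<And>k. 0 < s k" "\<And>k. s k < 1" and taylor: "\<And>k. f (X k + d k) =
      f (X k) + d k \<bullet> grad f (X k) + d k \<bullet> (hessian f (X k + s k *\<^sub>R d k) *v d k) / 2"
    by metis
  have "d \<longlonglongrightarrow> 0"
    unfolding d_def using tendsto_diff[OF Y X] by simp
  then have "(\<lambda>k. s k *\<^sub>R d k) \<longlonglongrightarrow> 0"
    by (rule metric_tendsto_imp_tendsto)
      (use s in \<open>auto intro!: always_eventually mult_left_le_one_le simp: less_imp_le\<close>)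
  then have "(\<lambda>k. X k + s k *\<^sub>R d k) \<longlonglongrightarrow> a"
    using tendsto_add[OF X] by fastforce
  then have "(\<lambda>k. hessian f (X k + s k *\<^sub>R d k)) \<longlonglongrightarrow> hessian f a"
    using isCont_tendsto_compose[OF twice_cont_diffD(3)[OF f]] by blast
  moreover have "u \<longlonglongrightarrow> w"
    using w by (simp add: u_def[abs_def] d_def)
  ultimately have lim: "(\<lambda>k. u k \<bullet> (hessian f (X k + s k *\<^sub>R d k) *v u k) / 2)
      \<longlonglongrightarrow> w \<bullet> (hessian f a *v w) / 2"
    unfolding matrix_vector_mult_def by (auto intro!: tendsto_intros)
  have "u k \<bullet> (hessian f (X k + s k *\<^sub>R d k) *v u k) / 2
      = (f (Y k) - f (X k) - (Y k - X k) \<bullet> grad f (X k)) / (norm (Y k - X k))\<^sup>2" for k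
  proof -
    have "f (Y k) - f (X k) - (Y k - X k) \<bullet> grad f (X k)
        = d k \<bullet> (hessian f (X k + s k *\<^sub>R d k) *v d k) / 2"
      using taylor[of k] by (simp add: d_def)
    then show ?thesis
      by (simp add: u_def d_def matrix_vector_mult_scaleR power2_eq_square divide_simps)
  qed
  with lim show ?thesis
    by simp
qed

lemma first_order_quotient_limit:
  fixes f :: "real ^ 'n \<Rightarrow> real"
  assumes f: "twice_cont_diff f" and X: "X \<longlonglongrightarrow> a" and Y: "Y \<longlonglongrightarrow> a"
    and w: "(\<lambda>k. (Y k - X k) /\<^sub>R norm (Y k - X k)) \<longlonglongrightarrow> w"
  shows "(\<lambda>k. (f (Y k) - f (X k)) / norm (Y k - X k)) \<longlonglongrightarrow> w \<bullet> grad f a"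
proof -
  define t where "t k = norm (Y k - X k)" for k
  define R where "R k = f (Y k) - f (X k) - (Y k - X k) \<bullet> grad f (X k)" for k
  have "t \<longlonglongrightarrow> 0"
    unfolding t_def using tendsto_norm[OF tendsto_diff[OF Y X]] by simp
  moreover have "(\<lambda>k. R k / (t k)\<^sup>2) \<longlonglongrightarrow> w \<bullet> (hessian f a *v w) / 2"
    unfolding R_def t_def by (rule second_order_quotient_limit[OF assms])
  moreover have "(\<lambda>k. grad f (X k)) \<longlonglongrightarrow> grad f a"
    using isCont_tendsto_compose[OF twice_cont_diffD(4)[OF f] X] .
  ultimately have "(\<lambda>k. t k * (R k / (t k)\<^sup>2) + ((Y k - X k) /\<^sub>R t k) \<bullet> grad f (X k))
      \<longlonglongrightarrow> 0 * (w \<bullet> (hessian f a *v w) / 2) + w \<bullet> grad f a"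
    using w unfolding t_def by (intro tendsto_add tendsto_mult tendsto_inner)
  moreover have "t k * (R k / (t k)\<^sup>2) + ((Y k - X k) /\<^sub>R t k) \<bullet> grad f (X k)
      = (f (Y k) - f (X k)) / norm (Y k - X k)" for k
    by (cases "t k = 0") (auto simp: R_def t_def power2_eq_square divide_simps)
  ultimately show ?thesis
    by simp
qed

section \<open>The Lagrangian\<close>

lemma GDERIV_lagrangian:
  fixes g :: "real ^ 'n \<Rightarrow> real" and q :: "real ^ 'n \<Rightarrow> real ^ 'm"
  assumes g: "twice_cont_diff g" and q: "\<And>i. twice_cont_diff (\<lambda>x. q x $ i)"
  shows "GDERIV (\<lambda>y. lagrangian g q y l) x
           :> grad g x + (\<Sum>i\<in>UNIV. l $ i *\<^sub>R grad (\<lambda>y. q y $ i) x)"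
proof -
  have "((\<lambda>y. g y + (\<Sum>i\<in>UNIV. l $ i * q y $ i)) has_derivative
      (\<lambda>h. h \<bullet> grad g x + (\<Sum>i\<in>UNIV. l $ i * (h \<bullet> grad (\<lambda>y. q y $ i) x)))) (at x)"
    using twice_cont_diffD(1)[OF g] twice_cont_diffD(1)[OF q] unfolding gderiv_def
    by (intro has_derivative_add has_derivative_sum has_derivative_mult_right) auto
  then show ?thesis
    unfolding gderiv_def lagrangian_def
    by (simp add: inner_vec_def[of l] inner_add_right inner_sum_right)
qed

lemma hessian_lagrangian:
  fixes g :: "real ^ 'n \<Rightarrow> real" and q :: "real ^ 'n \<Rightarrow> real ^ 'm"
  assumes g: "twice_cont_diff g" and q: "\<And>i. twice_cont_diff (\<lambda>x. q x $ i)"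
  shows "hessian (\<lambda>y. lagrangian g q y l) x *v w
           = hessian g x *v w + (\<Sum>i\<in>UNIV. l $ i *\<^sub>R (hessian (\<lambda>y. q y $ i) x *v w))"
proof -
  have eq: "grad (\<lambda>y. lagrangian g q y l)
      = (\<lambda>y. grad g y + (\<Sum>i\<in>UNIV. l $ i *\<^sub>R grad (\<lambda>y. q y $ i) y))"
    using grad_eqI[OF GDERIV_lagrangian[OF g q]] by blast
  have D: "(grad (\<lambda>y. lagrangian g q y l) has_derivative
      (\<lambda>w. hessian g x *v w + (\<Sum>i\<in>UNIV. l $ i *\<^sub>R (hessian (\<lambda>y. q y $ i) x *v w)))) (at x)"
    unfolding eq
    by (intro has_derivative_add has_derivative_sum has_derivative_scaleR_right
        twice_cont_diffD(2)[OF g] twice_cont_diffD(2)[OF q])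
  from D have "(grad (\<lambda>y. lagrangian g q y l) has_derivative
      (\<lambda>w. hessian (\<lambda>y. lagrangian g q y l) x *v w)) (at x)"
    unfolding hessian_def jacobian_works[symmetric] differentiable_def by blast
  then show ?thesis
    using has_derivative_unique[OF _ D] by meson
qed

lemma transpose_jacobian_mult:
  fixes q :: "real ^ 'n \<Rightarrow> real ^ 'm"
  assumes "\<And>i. GDERIV (\<lambda>y. q y $ i) x :> grad (\<lambda>y. q y $ i) x"
  shows "transpose (jacobian q (at x)) *v l = (\<Sum>i\<in>UNIV. l $ i *\<^sub>R grad (\<lambda>y. q y $ i) x)"
proof -
  have D: "(q has_derivative (\<lambda>h. \<chi> i. h \<bullet> grad (\<lambda>y. q y $ i) x)) (at x)"
  proof (subst has_derivative_componentwise_within, rule ballI)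
    fix b :: "real ^ 'm"
    assume "b \<in> Basis"
    then obtain i where "b = axis i 1"
      by (auto simp: Basis_vec_def)
    then show "((\<lambda>x. q x \<bullet> b) has_derivative
        (\<lambda>h. (\<chi> i. h \<bullet> grad (\<lambda>y. q y $ i) x) \<bullet> b)) (at x)"
      using assms[of i] by (simp add: gderiv_def inner_axis)
  qed
  then have "(q has_derivative (\<lambda>h. jacobian q (at x) *v h)) (at x)"
    unfolding jacobian_works[symmetric] differentiable_def by blast
  from has_derivative_unique[OF this D]
  have J: "jacobian q (at x) *v h = (\<chi> i. h \<bullet> grad (\<lambda>y. q y $ i) x)" for h
    by (rule fun_cong)
  have "h \<bullet> (transpose (jacobian q (at x)) *v l)
      = h \<bullet> (\<Sum>i\<in>UNIV. l $ i *\<^sub>R grad (\<lambda>y. q y $ i) x)" for h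
  proof -
    have "h \<bullet> (transpose (jacobian q (at x)) *v l) = l \<bullet> (jacobian q (at x) *v h)"
      using dot_lmul_matrix[of l "jacobian q (at x)" h] by (simp add: inner_commute)
    then show ?thesis
      by (simp add: J inner_vec_def[of l] inner_sum_right)
  qed
  then show ?thesis
    by (rule vector_eq_ldot[THEN iffD1, OF allI])
qed

section \<open>Multipliers from metric subregularity\<close>

lemma GDERIV_directional_limit:
  assumes "GDERIV f x :> D"
  shows "((\<lambda>t. (f (x + t *\<^sub>R w) - f x) / t) \<longlongrightarrow> w \<bullet> D) (at_right 0)"
proof -
  have "((\<lambda>t. x + t *\<^sub>R w) has_derivative (\<lambda>h. h *\<^sub>R w)) (at 0)"
    by (auto intro!: derivative_eq_intros)
  then have "((\<lambda>t. f (x + t *\<^sub>R w)) has_derivative (\<lambda>h. (h *\<^sub>R w) \<bullet> D)) (at 0)"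
    using has_derivative_compose[of "\<lambda>t. x + t *\<^sub>R w"] assms unfolding gderiv_def by fastforce
  then have "((\<lambda>t. f (x + t *\<^sub>R w)) has_field_derivative (w \<bullet> D)) (at 0)"
    by (simp add: has_field_derivative_def mult_commute_abs)
  then show ?thesis
    using filterlim_at_split by (simp add: has_field_derivative_iff) blast
qed

text \<open>The combinations of the active gradients with coefficients in \<open>[0, l * c]\<close> form a compact
  convex set. If it did not contain \<open>- df\<close>, a separating hyperplane would give a direction \<open>w\<close>
  in which the exact penalty function \<open>f + l * c * (\<Sum>i. max 0 (q\<^sub>i))\<close> strictly decreases. The
  feasible point nearest to \<open>x + t *\<^sub>R w\<close> costs at most \<open>l\<close> times its distance, which subregularity
  bounds by the penalty term; so that feasible point would lie strictly below \<open>f x\<close>.\<close>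

lemma bounded_multipliers:
  fixes f :: "real ^ 'n \<Rightarrow> real" and q :: "real ^ 'n \<Rightarrow> real ^ 'm"
  assumes df: "GDERIV f x :> df" and dq: "\<And>i. GDERIV (\<lambda>y. q y $ i) x :> dq i"
    and cl: "closed (feasible_set q)" and x: "x \<in> feasible_set q"
    and U: "open U" "x \<in> U" and c: "0 \<le> c"
    and sub: "\<And>y. y \<in> U \<Longrightarrow> infdist y (feasible_set q) \<le> c * infdist (q y) nonpos_orthant"
    and r: "0 < r" and min: "\<And>z. z \<in> feasible_set q \<Longrightarrow> z \<in> cball x r \<Longrightarrow> f x \<le> f z"
    and lip: "l-lipschitz_on (cball x r) f"
  shows "\<exists>u. (\<forall>i. 0 \<le> u $ i \<and> u $ i \<le> l * c \<and> u $ i * q x $ i = 0) \<and>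
             df + (\<Sum>i\<in>UNIV. u $ i *\<^sub>R dq i) = 0"
proof -
  define b :: "real ^ 'm" where "b = (\<chi> i. if q x $ i = 0 then l * c else 0)"
  define comb where "comb u = (\<Sum>i\<in>UNIV. u $ i *\<^sub>R dq i)" for u :: "real ^ 'm"
  have l0: "0 \<le> l"
    using lipschitz_on_nonneg[OF lip] .
  have lin: "linear comb"
    unfolding comb_def
    by (intro linearI) (auto simp: scaleR_left_distrib sum.distrib scaleR_sum_right)
  have "- df \<in> comb ` cbox 0 b"
  proof (rule ccontr)
    assume notin: "- df \<notin> comb ` cbox 0 b"
    have "convex (comb ` cbox 0 b)" "closed (comb ` cbox 0 b)"
      using lin by (auto intro!: convex_linear_image compact_imp_closed compact_continuous_image
          linear_continuous_on linear_conv_bounded_linear[THEN iffD1])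
    from separating_hyperplane_closed_point[OF this notin]
    obtain a \<beta> where a: "a \<bullet> (- df) < \<beta>" "\<And>z. z \<in> comb ` cbox 0 b \<Longrightarrow> \<beta> < a \<bullet> z"
      by blast
    define w where "w = - a"
    define p where "p i = (if q x $ i = 0 then max 0 (w \<bullet> dq i) else 0)" for i
    \<comment> \<open>A maximizer of \<open>w \<bullet> comb\<close> over the box: its value is the directional derivative of the
      penalty term.\<close>
    define u :: "real ^ 'm" where "u = (\<chi> i. if q x $ i = 0 \<and> 0 < w \<bullet> dq i then l * c else 0)"
    have "u \<in> cbox 0 b"
      using l0 c by (auto simp: u_def b_def mem_box_cart)
    then have "w \<bullet> df + w \<bullet> comb u < 0"
      using a(1) a(2)[of "comb u"] by (auto simp: w_def)
    moreover have "w \<bullet> comb u = l * c * (\<Sum>i\<in>UNIV. p i)"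
      unfolding comb_def inner_sum_right sum_distrib_left
      by (intro sum.cong) (auto simp: u_def p_def)
    ultimately have neg: "w \<bullet> df + l * c * (\<Sum>i\<in>UNIV. p i) < 0"
      by simp
    define y where "y t = x + t *\<^sub>R w" for t :: real
    \<comment> \<open>The sum of positive parts overestimates the distance of \<open>q\<close> to the orthant; it is
      preferred to the Euclidean norm because it is the support function of the box \<open>[0, 1]\<^sup>m\<close>,
      which matches the box of coefficients.\<close>
    define \<Phi> where "\<Phi> t = f (y t) + l * c * (\<Sum>i\<in>UNIV. max 0 (q (y t) $ i))" for t
    have pos: "eventually (\<lambda>t::real. 0 < t) (at_right 0)"
      by (simp add: eventually_at_right_less)
    have y: "(y \<longlongrightarrow> x) (at_right 0)"
      unfolding y_def by (auto intro!: tendsto_eq_intros)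
    have "((\<lambda>t. max 0 (q (y t) $ i) / t) \<longlongrightarrow> p i) (at_right 0)" for i
    proof (cases "q x $ i = 0")
      case True
      have "((\<lambda>t. max 0 ((q (y t) $ i - q x $ i) / t)) \<longlongrightarrow> max 0 (w \<bullet> dq i)) (at_right 0)"
        unfolding y_def by (intro tendsto_max tendsto_const GDERIV_directional_limit[OF dq])
      then have "((\<lambda>t. max 0 ((q (y t) $ i - q x $ i) / t)) \<longlongrightarrow> p i) (at_right 0)"
        using True by (simp add: p_def)
      then show ?thesis
        by (rule Lim_transform_eventually)
          (use pos True in \<open>auto elim!: eventually_mono simp: max_def divide_simps\<close>)
    next
      case False
      then have "q x $ i < 0"
        using x by (auto simp: feasible_set_def less_le)
      moreover have "((\<lambda>t. q (y t) $ i) \<longlongrightarrow> q x $ i) (at_right 0)"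
        using dq[of i] y
        unfolding gderiv_def by (intro isCont_tendsto_compose[of x "\<lambda>y. q y $ i"])
          (auto intro: has_derivative_continuous)
      ultimately have "eventually (\<lambda>t. q (y t) $ i < 0) (at_right 0)"
        by (simp add: order_tendstoD(2))
      then have "eventually (\<lambda>t. max 0 (q (y t) $ i) / t = 0) (at_right 0)"
        by eventually_elim auto
      from tendsto_eventually[OF this] show ?thesis
        using False by (simp add: p_def)
    qed
    then have "((\<lambda>t. (f (x + t *\<^sub>R w) - f x) / t + l * c * (\<Sum>i\<in>UNIV. max 0 (q (y t) $ i) / t))
        \<longlongrightarrow> w \<bullet> df + l * c * (\<Sum>i\<in>UNIV. p i)) (at_right 0)"
      by (intro tendsto_intros GDERIV_directional_limit[OF df]) auto
    then have "eventually (\<lambda>t. (f (x + t *\<^sub>R w) - f x) / t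
        + l * c * (\<Sum>i\<in>UNIV. max 0 (q (y t) $ i) / t) < 0) (at_right 0)"
      using neg by (simp add: order_tendstoD(2))
    moreover have "eventually (\<lambda>t. y t \<in> U) (at_right 0)"
      using y U by (auto simp: tendsto_def)
    moreover have "((\<lambda>t. 2 * (t * norm w)) \<longlongrightarrow> 2 * (0 * norm w)) (at_right 0)"
      by (intro tendsto_intros)
    then have "eventually (\<lambda>t. 2 * (t * norm w) < r) (at_right 0)"
      using r order_tendstoD(2)[of _ "2 * (0 * norm w)"] by auto
    ultimately have "eventually (\<lambda>t. 0 < t \<and> y t \<in> U \<and> 2 * (t * norm w) < r \<and>
        (f (x + t *\<^sub>R w) - f x) / t + l * c * (\<Sum>i\<in>UNIV. max 0 (q (y t) $ i) / t) < 0)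
        (at_right (0::real))"
      using pos by eventually_elim auto
    then obtain t where t: "0 < t" "y t \<in> U" "2 * (t * norm w) < r"
      and quot: "(f (x + t *\<^sub>R w) - f x) / t + l * c * (\<Sum>i\<in>UNIV. max 0 (q (y t) $ i) / t) < 0"
      using eventually_happens'[OF trivial_limit_at_right_real] by blast
    have "(\<Phi> t - f x) / t < 0"
      using quot by (simp add: \<Phi>_def y_def sum_divide_distrib[symmetric] diff_divide_distrib
          add_divide_distrib)
    then have \<Phi>: "\<Phi> t < f x"
      using t(1) by (simp add: divide_less_0_iff)
    obtain z where z: "z \<in> feasible_set q" "infdist (y t) (feasible_set q) = dist (y t) z"
      using infdist_attains_inf[OF cl, of "y t"] x by auto
    have yx: "dist (y t) x = t * norm w"
      using t(1) by (simp add: y_def dist_norm)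
    then have "dist (y t) z \<le> t * norm w"
      using infdist_le[OF x, of "y t"] z(2) by simp
    moreover have "0 \<le> t * norm w"
      using t(1) by simp
    ultimately have zr: "z \<in> cball x r" and yr: "y t \<in> cball x r"
      using dist_triangle[of x z "y t"] yx t(3) by (simp_all add: dist_commute)
    have "infdist (q (y t)) nonpos_orthant \<le> dist (q (y t)) (\<chi> i. min 0 (q (y t) $ i))"
      by (intro infdist_le) (simp add: nonpos_orthant_def)
    also have "\<dots> \<le> (\<Sum>i\<in>UNIV. \<bar>(q (y t) - (\<chi> i. min 0 (q (y t) $ i))) $ i\<bar>)"
      unfolding dist_norm by (rule norm_le_l1_cart)
    also have "\<dots> = (\<Sum>i\<in>UNIV. max 0 (q (y t) $ i))"
      by (intro sum.cong) auto
    finally have "dist (y t) z \<le> c * (\<Sum>i\<in>UNIV. max 0 (q (y t) $ i))"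
      using sub[OF t(2)] z(2) c by (metis mult_left_mono order_trans)
    then have "l * dist z (y t) \<le> l * c * (\<Sum>i\<in>UNIV. max 0 (q (y t) $ i))"
      using l0 by (metis dist_commute mult.assoc mult_left_mono)
    then have "f z \<le> \<Phi> t"
      using lipschitz_onD[OF lip zr yr] by (auto simp: \<Phi>_def dist_real_def)
    with \<Phi> min[OF z(1) zr] show False
      by simp
  qed
  then obtain u where u: "u \<in> cbox 0 b" "- df = comb u"
    by blast
  have "0 \<le> u $ i \<and> u $ i \<le> l * c \<and> u $ i * q x $ i = 0" for i
    using u(1) l0 c by (force simp: mem_box_cart b_def dest: spec[of _ i] split: if_splits)
  moreover have "df + comb u = 0"
    using u(2) by (simp add: neg_eq_iff_add_eq_0)
  ultimately show ?thesis
    unfolding comb_def by blast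
qed

section \<open>Uniform quadratic growth\<close>

text \<open>A compactness argument: if the growth fails with constants tending to \<open>0\<close>, the
  multipliers and the normalized directions \<open>(y - x) /\<^sub>R norm (y - x)\<close> accumulate at some \<open>l\<close> and
  \<open>w\<close>. In the limit, \<open>l\<close> is a multiplier at \<open>xbar\<close>, \<open>w\<close> is orthogonal to the gradients with
  positive multiplier, and the Hessian form of the Lagrangian at \<open>w\<close> is at most \<open>0\<close>,
  contrary to the second-order condition.\<close>

lemma uniform_quadratic_growth:
  fixes g :: "real ^ 'n \<Rightarrow> real" and q :: "real ^ 'n \<Rightarrow> real ^ 'm"
  assumes g: "twice_cont_diff g" and q: "\<And>i. twice_cont_diff (\<lambda>x. q x $ i)"
    and ssosc: "SSOSC g q xbar"
  obtains \<delta> \<alpha> where "0 < \<delta>" "0 < \<alpha>"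
    "\<And>x y l. \<lbrakk>x \<in> feasible_set q; y \<in> feasible_set q; dist x xbar \<le> \<delta>; dist y xbar \<le> \<delta>;
        \<And>i. 0 \<le> l $ i; \<And>i. l $ i \<le> M; \<And>i. l $ i * q x $ i = 0;
        norm (grad (\<lambda>y. lagrangian g q y l) x) \<le> \<delta>\<rbrakk>
      \<Longrightarrow> \<alpha> * (norm (y - x))\<^sup>2 \<le> g y - g x - (y - x) \<bullet> grad (\<lambda>y. lagrangian g q y l) x"
proof -
  define G where "G x l = grad (\<lambda>y. lagrangian g q y l) x" for x l
  define good where "good \<epsilon> x y l \<longleftrightarrow> x \<in> feasible_set q \<and> y \<in> feasible_set q \<and>
      dist x xbar \<le> \<epsilon> \<and> dist y xbar \<le> \<epsilon> \<and> (\<forall>i. 0 \<le> l $ i \<and> l $ i \<le> M \<and> l $ i * q x $ i = 0) \<and>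
      norm (G x l) \<le> \<epsilon>" for \<epsilon> x y l
  define D where "D x y l = g y - g x - (y - x) \<bullet> G x l" for x y l
  have G: "G x l = grad g x + (\<Sum>i\<in>UNIV. l $ i *\<^sub>R grad (\<lambda>y. q y $ i) x)" for x l
    unfolding G_def by (rule grad_eqI[OF GDERIV_lagrangian[OF g q]])
  have "\<exists>\<epsilon>>0. \<forall>x y l. good \<epsilon> x y l \<longrightarrow> \<epsilon> * (norm (y - x))\<^sup>2 \<le> D x y l"
  proof (rule ccontr)
    assume "\<not> ?thesis"
    then have "\<exists>x y l. good (inverse (real (Suc k))) x y l \<and>
        D x y l < inverse (real (Suc k)) * (norm (y - x))\<^sup>2" for k
      by (meson inverse_positive_iff_positive not_le of_nat_0_less_iff zero_less_Suc)
    then obtain X0 Y0 L0 where good0: "\<And>k. good (inverse (real (Suc k))) (X0 k) (Y0 k) (L0 k)"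
      and D0: "\<And>k. D (X0 k) (Y0 k) (L0 k) < inverse (real (Suc k)) * (norm (Y0 k - X0 k))\<^sup>2"
      by metis
    have ne0: "Y0 k \<noteq> X0 k" for k
      using D0[of k] by (auto simp: D_def)
    define P where "P k = (L0 k, (Y0 k - X0 k) /\<^sub>R norm (Y0 k - X0 k))" for k
    have "compact (cbox 0 (\<chi> i. M) \<times> sphere (0::real ^ 'n) 1 :: ((real ^ 'm) \<times> (real ^ 'n)) set)"
      by (intro compact_Times compact_cbox compact_sphere)
    moreover have "\<forall>k. P k \<in> cbox 0 (\<chi> i. M) \<times> sphere 0 1"
      using good0 ne0 by (auto simp: P_def good_def mem_box_cart)
    ultimately obtain lw \<phi> where "lw \<in> cbox 0 (\<chi> i. M) \<times> sphere 0 1" and \<phi>: "strict_mono \<phi>"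
      and lim: "(P \<circ> \<phi>) \<longlonglongrightarrow> lw"
      unfolding compact_def by meson
    then obtain l w where lw: "lw = (l, w)" and w: "norm w = 1" and l: "\<And>i. 0 \<le> l $ i"
      by (cases lw) (auto simp: mem_box_cart)
    define e where "e k = inverse (real (Suc (\<phi> k)))" for k
    define X where "X k = X0 (\<phi> k)" for k
    define Y where "Y k = Y0 (\<phi> k)" for k
    define L where "L k = L0 (\<phi> k)" for k
    define S where "S k = norm (Y k - X k)" for k
    have good: "good (e k) (X k) (Y k) (L k)" and De: "D (X k) (Y k) (L k) < e k * (S k)\<^sup>2" for k
      using good0 D0 by (auto simp: e_def X_def Y_def L_def S_def)
    have S: "0 < S k" for k
      using ne0 by (simp add: S_def X_def Y_def)
    have e: "e \<longlonglongrightarrow> 0"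
      using LIMSEQ_subseq_LIMSEQ[OF LIMSEQ_inverse_real_of_nat \<phi>] by (simp add: e_def[abs_def] o_def)
    have X: "X \<longlonglongrightarrow> xbar" and Y: "Y \<longlonglongrightarrow> xbar" and GL: "(\<lambda>k. G (X k) (L k)) \<longlonglongrightarrow> 0"
    proof -
      have "dist (X k) xbar \<le> dist (e k) 0" "dist (Y k) xbar \<le> dist (e k) 0"
        "dist (G (X k) (L k)) 0 \<le> dist (e k) 0" for k
        using good[of k] by (auto simp: good_def dist_real_def)
      then show "X \<longlonglongrightarrow> xbar" "Y \<longlonglongrightarrow> xbar" "(\<lambda>k. G (X k) (L k)) \<longlonglongrightarrow> 0"
        by (auto intro!: metric_tendsto_imp_tendsto[OF e] always_eventually)
    qed
    have L: "L \<longlonglongrightarrow> l"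
      using tendsto_fst[OF lim] by (simp add: lw P_def o_def L_def[abs_def])
    then have Li: "(\<lambda>k. L k $ i) \<longlonglongrightarrow> l $ i" for i
      by (rule tendsto_vec_nth)
    have W: "(\<lambda>k. (Y k - X k) /\<^sub>R norm (Y k - X k)) \<longlonglongrightarrow> w"
      using tendsto_snd[OF lim] by (simp add: lw P_def o_def X_def Y_def)
    have S0: "S \<longlonglongrightarrow> 0"
      unfolding S_def using tendsto_norm[OF tendsto_diff[OF Y X]] by simp

    have mult: "l \<in> multipliers q xbar (- grad g xbar)"
    proof -
      have "(\<lambda>k. G (X k) (L k)) \<longlonglongrightarrow> G xbar l"
        unfolding G
        by (intro tendsto_add tendsto_sum tendsto_scaleR Li
            isCont_tendsto_compose[OF twice_cont_diffD(4)[OF g] X]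
            isCont_tendsto_compose[OF twice_cont_diffD(4)[OF q] X])
      then have "G xbar l = 0"
        using GL LIMSEQ_unique by blast
      then have "transpose (jacobian q (at xbar)) *v l = - grad g xbar"
        unfolding transpose_jacobian_mult[OF twice_cont_diffD(1)[OF q]] G
        by (simp add: eq_neg_iff_add_eq_0 add.commute)
      moreover have "l $ i = 0" if "i \<notin> active_indices q xbar" for i
      proof -
        have "(\<lambda>k. L k $ i * q (X k) $ i) \<longlonglongrightarrow> l $ i * q xbar $ i"
          using isCont_tendsto_compose[OF twice_cont_diffD(5)[OF q] X] Li by (intro tendsto_mult)
        moreover have "L k $ i * q (X k) $ i = 0" for k
          using good by (simp add: good_def)
        ultimately have "l $ i * q xbar $ i = 0"
          by (simp add: LIMSEQ_const_iff)
        with that show ?thesis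
          by (simp add: active_indices_def)
      qed
      ultimately show ?thesis
        using l by (simp add: multipliers_def nonneg_orthant_def)
    qed

    \<comment> \<open>\<open>E k\<close> collects the Taylor remainders of \<open>g\<close> and of the \<open>q\<^sub>i\<close>, weighted by the multipliers
      and scaled by \<open>(S k)\<^sup>2\<close>; complementarity at \<open>X k\<close> leaves only \<open>- L k \<bullet> q (Y k)\<close> besides
      them.\<close>
    define E where "E k = (g (Y k) - g (X k) - (Y k - X k) \<bullet> grad g (X k)) / (S k)\<^sup>2
      + (\<Sum>i\<in>UNIV. L k $ i * ((q (Y k) $ i - q (X k) $ i
          - (Y k - X k) \<bullet> grad (\<lambda>y. q y $ i) (X k)) / (S k)\<^sup>2))" for k
    define H where "H = w \<bullet> (hessian (\<lambda>y. lagrangian g q y l) xbar *v w) / 2"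
    have "E \<longlonglongrightarrow> w \<bullet> (hessian g xbar *v w) / 2
        + (\<Sum>i\<in>UNIV. l $ i * (w \<bullet> (hessian (\<lambda>y. q y $ i) xbar *v w) / 2))"
      unfolding E_def[abs_def] S_def
      by (intro tendsto_add tendsto_sum tendsto_mult Li second_order_quotient_limit X Y W g q)
    moreover have "H = w \<bullet> (hessian g xbar *v w) / 2
        + (\<Sum>i\<in>UNIV. l $ i * (w \<bullet> (hessian (\<lambda>y. q y $ i) xbar *v w) / 2))"
      unfolding H_def hessian_lagrangian[OF g q]
      by (simp add: inner_add_right inner_sum_right add_divide_distrib sum_divide_distrib)
    ultimately have E: "E \<longlonglongrightarrow> H"
      by simp
    have comp: "L k $ i * q (X k) $ i = 0" and sgn: "L k $ i * q (Y k) $ i \<le> 0" for k i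
      using good[of k] by (auto simp: good_def feasible_set_def intro!: mult_nonneg_nonpos)
    have "D (X k) (Y k) (L k) = E k * (S k)\<^sup>2 - (\<Sum>i\<in>UNIV. L k $ i * q (Y k) $ i)" for k
    proof -
      have "E k * (S k)\<^sup>2 = (g (Y k) - g (X k) - (Y k - X k) \<bullet> grad g (X k))
        + (\<Sum>i\<in>UNIV. L k $ i * (q (Y k) $ i - q (X k) $ i
          - (Y k - X k) \<bullet> grad (\<lambda>y. q y $ i) (X k)))"
        using S[of k] by (simp add: E_def distrib_right sum_distrib_right mult.assoc)
      then show ?thesis
        by (simp add: D_def G inner_add_right inner_sum_right right_diff_distrib comp
            sum_subtractf)
    qed
    then have De': "E k * (S k)\<^sup>2 - (\<Sum>i\<in>UNIV. L k $ i * q (Y k) $ i) < e k * (S k)\<^sup>2" for k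
      using De by simp
    have bound: "- (L k $ i * q (Y k) $ i) < (e k - E k) * (S k)\<^sup>2" for k i
      using De'[of k] member_le_sum[of i UNIV "\<lambda>i. - (L k $ i * q (Y k) $ i)"] sgn
      by (simp add: sum_negf algebra_simps)
    have "E k \<le> e k" for k
    proof -
      have "0 < (e k - E k) * (S k)\<^sup>2"
        using bound sgn by (meson le_less_trans neg_0_le_iff_le)
      then show ?thesis
        using S[of k] by (simp add: zero_less_mult_iff)
    qed
    then have "H \<le> 0"
      using LIMSEQ_le[OF E e] by blast
    \<comment> \<open>The terms \<open>- L k $ i * q (Y k) $ i\<close> are of second order in \<open>S k\<close>, but their quotients by
      \<open>S k\<close> tend to \<open>- l $ i * (w \<bullet> grad q\<^sub>i)\<close>; hence this limit vanishes.\<close>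
    moreover have "grad (\<lambda>y. q y $ i) xbar \<bullet> w = 0" if "i \<in> positive_indices l" for i
    proof -
      define Z where "Z k = - (L k $ i * q (Y k) $ i) / S k" for k
      have "(\<lambda>k. - (L k $ i * ((q (Y k) $ i - q (X k) $ i) / S k)))
          \<longlonglongrightarrow> - (l $ i * (w \<bullet> grad (\<lambda>y. q y $ i) xbar))"
        unfolding S_def
        by (intro tendsto_minus tendsto_mult Li first_order_quotient_limit X Y W q)
      moreover have "- (L k $ i * ((q (Y k) $ i - q (X k) $ i) / S k)) = Z k" for k
        using comp[of k i] by (simp add: Z_def right_diff_distrib)
      ultimately have Z: "Z \<longlonglongrightarrow> - (l $ i * (w \<bullet> grad (\<lambda>y. q y $ i) xbar))"
        by simp
      have "0 \<le> Z k" for k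
        using S[of k] sgn[of k i] by (simp add: Z_def divide_nonpos_pos)
      moreover have "Z k \<le> (e k - E k) * S k" for k
        using less_imp_le[OF bound[of k i]] unfolding Z_def pos_divide_le_eq[OF S]
        by (simp add: power2_eq_square mult.assoc)
      moreover have "(\<lambda>k. (e k - E k) * S k) \<longlonglongrightarrow> (0 - H) * 0"
        by (intro tendsto_intros e E S0)
      ultimately have "Z \<longlonglongrightarrow> 0"
        using real_tendsto_sandwich[of "\<lambda>_. 0" Z sequentially "\<lambda>k. (e k - E k) * S k" 0] by simp
      with Z have "- (l $ i * (w \<bullet> grad (\<lambda>y. q y $ i) xbar)) = 0"
        by (rule LIMSEQ_unique)
      with that show ?thesis
        by (simp add: positive_indices_def inner_commute)
    qed
    moreover have "w \<noteq> 0"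
      using w by auto
    ultimately have "H \<le> 0" "w \<noteq> 0 \<and> (\<forall>i\<in>positive_indices l. grad (\<lambda>y. q y $ i) xbar \<bullet> w = 0)"
      by blast+
    moreover from this(2) have "0 < w \<bullet> (hessian (\<lambda>y. lagrangian g q y l) xbar *v w)"
      using ssosc mult unfolding SSOSC_def by blast
    ultimately show False
      by (simp add: H_def)
  qed
  then obtain \<epsilon> where \<epsilon>: "0 < \<epsilon>"
    and growth: "\<And>x y l. good \<epsilon> x y l \<Longrightarrow> \<epsilon> * (norm (y - x))\<^sup>2 \<le> D x y l"
    by blast
  show ?thesis
  proof (rule that[OF \<epsilon> \<epsilon>])
    fix x y l
    assume "x \<in> feasible_set q" "y \<in> feasible_set q" "dist x xbar \<le> \<epsilon>" "dist y xbar \<le> \<epsilon>"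
      "\<And>i. 0 \<le> l $ i" "\<And>i. l $ i \<le> M" "\<And>i. l $ i * q x $ i = 0"
      "norm (grad (\<lambda>y. lagrangian g q y l) x) \<le> \<epsilon>"
    then have "good \<epsilon> x y l"
      unfolding good_def G_def by blast
    from growth[OF this]
    show "\<epsilon> * (norm (y - x))\<^sup>2 \<le> g y - g x - (y - x) \<bullet> grad (\<lambda>y. lagrangian g q y l) x"
      unfolding D_def G_def .
  qed
qed

section \<open>Tilt stability\<close>

lemma closed_feasible_set:
  fixes q :: "real ^ 'n \<Rightarrow> real ^ 'm"
  assumes q: "\<And>i. twice_cont_diff (\<lambda>x. q x $ i)"
  shows "closed (feasible_set q)"
  unfolding feasible_set_def using twice_cont_diffD(5)[OF q]
  by (intro closed_Collect_all closed_Collect_le continuous_at_imp_continuous_on) auto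

lemma GDERIV_tilted:
  fixes g :: "real ^ 'n \<Rightarrow> real"
  assumes "twice_cont_diff g"
  shows "GDERIV (\<lambda>x. g x - v \<bullet> x) x :> grad g x - v"
  using twice_cont_diffD(1)[OF assms, of x] unfolding gderiv_def
  by (auto intro!: derivative_eq_intros simp: inner_diff_right inner_commute)

text \<open>One constant has to serve all small tilts, since it enters the common bound on the
  multipliers.\<close>

lemma tilted_lipschitz_on_cball:
  fixes g :: "real ^ 'n \<Rightarrow> real"
  assumes g: "twice_cont_diff g"
  obtains K where "\<And>v. norm v \<le> 1 \<Longrightarrow> K-lipschitz_on (cball a r) (\<lambda>x. g x - v \<bullet> x)"
proof -
  have "compact (grad g ` cball a r)"
    using twice_cont_diffD(4)[OF g]
    by (intro compact_continuous_image compact_cball continuous_at_imp_continuous_on) auto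
  then obtain B where B: "0 < B" "\<And>x. x \<in> cball a r \<Longrightarrow> norm (grad g x) \<le> B"
    using bounded_pos compact_imp_bounded by (metis imageI)
  have "(B + 1)-lipschitz_on (cball a r) (\<lambda>x. g x - v \<bullet> x)" if v: "norm v \<le> 1" for v
  proof (rule lipschitz_onI)
    fix x y assume xy: "x \<in> cball a r" "y \<in> cball a r"
    have "norm ((g x - v \<bullet> x) - (g y - v \<bullet> y)) \<le> (B + 1) * norm (x - y)"
    proof (rule differentiable_bound[where f' = "\<lambda>z h. h \<bullet> (grad g z - v)"])
      show "((\<lambda>x. g x - v \<bullet> x) has_derivative (\<lambda>h. h \<bullet> (grad g z - v)))
          (at z within cball a r)" for z
        using GDERIV_tilted[OF g, of v z] has_derivative_at_withinI unfolding gderiv_def by blast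
      show "onorm (\<lambda>h. h \<bullet> (grad g z - v)) \<le> B + 1" if z: "z \<in> cball a r" for z
      proof (rule onorm_le)
        fix h :: "real ^ 'n"
        have "norm (grad g z - v) \<le> B + 1"
          using B(2)[OF z] v norm_triangle_ineq4[of "grad g z" v] by simp
        then have "norm h * norm (grad g z - v) \<le> norm h * (B + 1)"
          by (simp add: mult_left_mono)
        then show "norm (h \<bullet> (grad g z - v)) \<le> (B + 1) * norm h"
          using Cauchy_Schwarz_ineq2[of h "grad g z - v"] by (simp add: mult.commute)
      qed
    qed (use xy in auto)
    then show "dist (g x - v \<bullet> x) (g y - v \<bullet> y) \<le> (B + 1) * dist x y"
      by (simp add: dist_norm)
  qed (use B in simp)
  then show ?thesis
    using that by blast
qed

text \<open>Growth around every tilted minimizer is strong monotonicity of the inverse of the minimizer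
  mapping: the increments of \<open>g\<close> cancel when the inequalities at two minimizers are added.\<close>

lemma tilt_stable_of_quadratic_growth:
  fixes g :: "real ^ 'n \<Rightarrow> real" and q :: "real ^ 'n \<Rightarrow> real ^ 'm"
  assumes xbar: "xbar \<in> feasible_set q" and pos: "0 < \<alpha>" "0 < \<gamma>" "0 < \<rho>"
    and base: "xbar \<in> tilted_argmin g q xbar \<gamma> 0"
    and ex: "\<And>v. tilted_argmin g q xbar \<gamma> v \<noteq> {}"
    and growth: "\<And>v x y. \<lbrakk>norm v < \<rho>; x \<in> tilted_argmin g q xbar \<gamma> v; y \<in> feasible_set q;
        dist y xbar \<le> \<gamma>\<rbrakk> \<Longrightarrow> \<alpha> * (norm (y - x))\<^sup>2 \<le> g y - g x - (y - x) \<bullet> v"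
  shows "tilt_stable_with_modulus g q xbar (1 / (2 * \<alpha>))"
proof -
  have feas: "x \<in> feasible_set q \<and> dist x xbar \<le> \<gamma>" if "x \<in> tilted_argmin g q xbar \<gamma> v" for x v
    using that by (auto simp: tilted_argmin_def is_arg_min_def dist_commute)
  have est: "2 * \<alpha> * norm (y - x) \<le> norm (w - v)"
    if v: "norm v < \<rho>" "x \<in> tilted_argmin g q xbar \<gamma> v"
      and w: "norm w < \<rho>" "y \<in> tilted_argmin g q xbar \<gamma> w" for v w x y
  proof (cases "y = x")
    case False
    have "2 * \<alpha> * (norm (y - x))\<^sup>2 \<le> (y - x) \<bullet> (w - v)"
      using growth[OF v, of y] growth[OF w, of x] feas[OF v(2)] feas[OF w(2)]
      by (simp add: inner_diff_left inner_diff_right norm_minus_commute)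
    also have "\<dots> \<le> norm (y - x) * norm (w - v)"
      by (rule norm_cauchy_schwarz)
    finally show ?thesis
      using False by (simp add: power2_eq_square)
  qed simp
  define s where "s v = (SOME x. x \<in> tilted_argmin g q xbar \<gamma> v)" for v
  have s: "s v \<in> tilted_argmin g q xbar \<gamma> v" for v
    unfolding s_def using ex by (simp add: some_in_eq)
  have unique: "x = s v" if "norm v < \<rho>" "x \<in> tilted_argmin g q xbar \<gamma> v" for v x
    using est[OF that(1) s that] pos by (simp add: mult_le_0_iff)
  have "tilted_argmin g q xbar \<gamma> v = {s v}" if "v \<in> ball 0 \<rho>" for v
    using that s unique by auto
  moreover have "(1 / (2 * \<alpha>))-lipschitz_on (ball 0 \<rho>) s"
  proof (rule lipschitz_onI)
    fix v w :: "real ^ 'n" assume "v \<in> ball 0 \<rho>" "w \<in> ball 0 \<rho>"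
    then show "dist (s v) (s w) \<le> 1 / (2 * \<alpha>) * dist v w"
      using est[OF _ s _ s, of w v] pos by (simp add: dist_norm field_simps)
  qed (use pos in simp)
  moreover have "s 0 = xbar"
    using unique[OF _ base] pos by simp
  ultimately show ?thesis
    unfolding tilt_stable_with_modulus_def using xbar pos
    by (auto intro!: exI[of _ \<gamma>] exI[of _ "ball 0 \<rho>"] exI[of _ s])
qed

theorem corollary4p12:
  fixes g :: "real ^ 'n \<Rightarrow> real"
    and q :: "real ^ 'n \<Rightarrow> real ^ 'm"
    and xbar :: "real ^ 'n"
  assumes "twice_cont_diff g"
    and "\<forall>i. twice_cont_diff (\<lambda>x. q x $ i)"
    and "xbar \<in> feasible_set q"
    and "stationary_point g q xbar"
    and "MSCQ q xbar"
    and "SSOSC g q xbar"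
  shows "tilt_stable_local_minimizer g q xbar"
proof -
  note g = assms(1) and xbar = assms(3)
  have q: "twice_cont_diff (\<lambda>x. q x $ i)" for i
    using assms(2) by blast
  have cl: "closed (feasible_set q)"
    by (rule closed_feasible_set[OF q])
  obtain U c where U: "open U" "xbar \<in> U" "0 < c"
    and sub: "\<And>x. x \<in> U \<Longrightarrow> infdist x (feasible_set q) \<le> c * infdist (q x) nonpos_orthant"
    using assms(5) unfolding MSCQ_def by blast
  obtain l0 where l0: "\<And>i. 0 \<le> l0 $ i" "\<And>i. l0 $ i * q xbar $ i = 0"
    and stat: "grad (\<lambda>y. lagrangian g q y l0) xbar = 0"
    using assms(4) unfolding stationary_point_def nonneg_orthant_def by blast
  obtain K where lip: "\<And>v. norm v \<le> 1 \<Longrightarrow> K-lipschitz_on (cball xbar 1) (\<lambda>x. g x - v \<bullet> x)"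
    using tilted_lipschitz_on_cball[OF g] by blast
  \<comment> \<open>The first bound is that of \<open>bounded_multipliers\<close> for tilted minimizers; the second admits
    the given multiplier \<open>l0\<close>, which yields growth at \<open>xbar\<close> before any minimizer is known.\<close>
  define M where "M = max (K * c) (norm l0)"
  obtain \<delta> \<alpha> where \<delta>: "0 < \<delta>" and \<alpha>: "0 < \<alpha>" and growth:
    "\<And>x y l. \<lbrakk>x \<in> feasible_set q; y \<in> feasible_set q; dist x xbar \<le> \<delta>; dist y xbar \<le> \<delta>;
        \<And>i. 0 \<le> l $ i; \<And>i. l $ i \<le> M; \<And>i. l $ i * q x $ i = 0;
        norm (grad (\<lambda>y. lagrangian g q y l) x) \<le> \<delta>\<rbrakk>
      \<Longrightarrow> \<alpha> * (norm (y - x))\<^sup>2 \<le> g y - g x - (y - x) \<bullet> grad (\<lambda>y. lagrangian g q y l) x"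
    using uniform_quadratic_growth[OF g q assms(6), of M] by blast
  obtain r where r: "0 < r" "cball xbar r \<subseteq> U"
    using open_contains_cball U by blast
  define \<gamma> where "\<gamma> = min r (min \<delta> 1)"
  \<comment> \<open>A minimizer for the tilt \<open>v\<close> satisfies \<open>\<alpha> * dist x xbar \<le> norm v\<close> by growth at \<open>xbar\<close>, so
    \<open>norm v < \<alpha> * \<gamma>\<close> keeps it off the boundary of the ball.\<close>
  define \<rho> where "\<rho> = min \<delta> (min 1 (\<alpha> * \<gamma>))"
  have \<gamma>: "0 < \<gamma>" "\<gamma> \<le> r" "\<gamma> \<le> \<delta>" "\<gamma> \<le> 1"
    using r \<delta> by (auto simp: \<gamma>_def)
  have \<rho>: "0 < \<rho>" "\<rho> \<le> \<delta>" "\<rho> \<le> 1" "\<rho> \<le> \<alpha> * \<gamma>"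
    using \<delta> \<alpha> \<gamma> by (auto simp: \<rho>_def)
  have growth0: "\<alpha> * (norm (y - xbar))\<^sup>2 \<le> g y - g xbar"
    if "y \<in> feasible_set q" "dist y xbar \<le> \<gamma>" for y
  proof -
    have "l0 $ i \<le> M" for i
      using component_le_norm_cart[of l0 i] by (auto simp: M_def)
    then show ?thesis
      using growth[of xbar y l0] xbar that l0 stat \<delta> \<gamma> by simp
  qed
  have argmin: "x \<in> tilted_argmin g q xbar \<gamma> v \<longleftrightarrow> x \<in> feasible_set q \<and> dist x xbar \<le> \<gamma> \<and>
      (\<forall>y\<in>feasible_set q. dist y xbar \<le> \<gamma> \<longrightarrow> g x - v \<bullet> x \<le> g y - v \<bullet> y)" for x v
    by (auto simp: tilted_argmin_def is_arg_min_linorder dist_commute)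
  have "tilt_stable_with_modulus g q xbar (1 / (2 * \<alpha>))"
  proof (rule tilt_stable_of_quadratic_growth[OF xbar \<alpha> \<gamma>(1) \<rho>(1)])
    show "xbar \<in> tilted_argmin g q xbar \<gamma> 0"
      unfolding argmin
    proof (intro conjI ballI impI)
      fix y assume "y \<in> feasible_set q" "dist y xbar \<le> \<gamma>"
      from growth0[OF this] have "\<alpha> * (norm (y - xbar))\<^sup>2 \<le> g y - g xbar" .
      moreover have "0 \<le> \<alpha> * (norm (y - xbar))\<^sup>2"
        using \<alpha> by simp
      ultimately show "g xbar - 0 \<bullet> xbar \<le> g y - 0 \<bullet> y"
        by simp
    qed (use xbar \<gamma> in auto)
  next
    fix v
    have "\<exists>x\<in>feasible_set q \<inter> cball xbar \<gamma>. \<forall>y\<in>feasible_set q \<inter> cball xbar \<gamma>.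
        g x - v \<bullet> x \<le> g y - v \<bullet> y"
    proof (rule continuous_attains_inf)
      show "compact (feasible_set q \<inter> cball xbar \<gamma>)"
        using cl by (simp add: closed_Int_compact)
      show "continuous_on (feasible_set q \<inter> cball xbar \<gamma>) (\<lambda>x. g x - v \<bullet> x)"
        using twice_cont_diffD(5)[OF g]
        by (intro continuous_intros continuous_at_imp_continuous_on) auto
    qed (use xbar \<gamma> in auto)
    then show "tilted_argmin g q xbar \<gamma> v \<noteq> {}"
      by (auto simp: argmin dist_commute ex_in_conv[symmetric])
  next
    fix v x y
    assume v: "norm v < \<rho>" and x: "x \<in> tilted_argmin g q xbar \<gamma> v"
      and y: "y \<in> feasible_set q" "dist y xbar \<le> \<gamma>"
    have xf: "x \<in> feasible_set q" and xd: "dist x xbar \<le> \<gamma>"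
      and xmin: "\<And>z. \<lbrakk>z \<in> feasible_set q; dist z xbar \<le> \<gamma>\<rbrakk> \<Longrightarrow> g x - v \<bullet> x \<le> g z - v \<bullet> z"
      using x by (auto simp: argmin)
    have "dist x xbar < \<gamma>"
    proof (cases "x = xbar")
      case False
      have "\<alpha> * (norm (x - xbar))\<^sup>2 \<le> v \<bullet> (x - xbar)"
        using growth0[OF xf xd] xmin[OF xbar] \<gamma> by (simp add: inner_diff_right)
      also have "\<dots> \<le> norm v * norm (x - xbar)"
        by (rule norm_cauchy_schwarz)
      finally have "\<alpha> * norm (x - xbar) \<le> norm v"
        using False by (simp add: power2_eq_square)
      also have "\<dots> < \<alpha> * \<gamma>"
        using v \<rho> by simp
      finally show ?thesis
        using \<alpha> by (simp add: dist_norm)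
    qed (use \<gamma> in simp)
    define t where "t = \<gamma> - dist x xbar"
    have t: "0 < t" "cball x t \<subseteq> cball xbar \<gamma>"
      using \<open>dist x xbar < \<gamma>\<close> by (simp_all add: t_def cball_subset_cball_iff)
    have "\<exists>l. (\<forall>i. 0 \<le> l $ i \<and> l $ i \<le> K * c \<and> l $ i * q x $ i = 0) \<and>
        (grad g x - v) + (\<Sum>i\<in>UNIV. l $ i *\<^sub>R grad (\<lambda>y. q y $ i) x) = 0"
    proof (rule bounded_multipliers[OF GDERIV_tilted[OF g] twice_cont_diffD(1)[OF q] cl xf U(1)])
      show "x \<in> U"
        using xd \<gamma> r by (auto simp: dist_commute)
      show "g x - v \<bullet> x \<le> g z - v \<bullet> z" if "z \<in> feasible_set q" "z \<in> cball x t" for z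
        using that t xmin[of z] by (auto simp: dist_commute)
      show "K-lipschitz_on (cball x t) (\<lambda>x. g x - v \<bullet> x)"
        using lip[of v] v \<rho> subset_cball[OF \<gamma>(4), of xbar] t(2)
        by (meson lipschitz_on_subset less_imp_le order_trans)
    qed (use sub U t in auto)
    then obtain l where l: "\<And>i. 0 \<le> l $ i" "\<And>i. l $ i \<le> K * c" "\<And>i. l $ i * q x $ i = 0"
      and kkt: "(grad g x - v) + (\<Sum>i\<in>UNIV. l $ i *\<^sub>R grad (\<lambda>y. q y $ i) x) = 0"
      by blast
    have "grad (\<lambda>y. lagrangian g q y l) x = v"
      using kkt unfolding grad_eqI[OF GDERIV_lagrangian[OF g q]] by (simp add: algebra_simps)
    moreover have "l $ i \<le> M" for i
      using l(2)[of i] by (auto simp: M_def)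
    ultimately show "\<alpha> * (norm (y - x))\<^sup>2 \<le> g y - g x - (y - x) \<bullet> v"
      using growth[of x y l] xf y xd l v \<rho> \<gamma> by simp
  qed
  then show ?thesis
    unfolding tilt_stable_local_minimizer_def using \<alpha> by (auto intro!: exI[of _ "1 / (2 * \<alpha>)"])
qed

end
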